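(* Let $k\in\{1,2\}$. If $G$ is a $k$-connected graph with $\alpha(G)\le k+2$, then every longest path in $G$ contains every vertex of $G$ of degree at least $\Delta(G)-(2-k)$.
   Context: All graphs are finite and simple. $\alpha(G)$ is the independence number and $\Delta(G)$ the maximum degree of $G$. A graph $G$ is $k$-connected if $|V(G)|>k$ and $G-S$ is connected for each $S\subseteq V(G)$ with $|S|<k$. *)

theory Defs
  imports "Graph_Theory.Digraph_Component" "Graph_Theory.Vertex_Walk"
begin

text \<open>Finite simple graphs are the symmetric digraphs of locale \<^locale>\<open>graph\<close>: each edge is a
  pair of opposite arcs, so the degree of a vertex is its \<^const>\<open>out_degree\<close>.\<close>

definition max_degree :: "('a, 'b) pre_digraph \<Rightarrow> nat" where
  "max_degree G = Max (out_degree G ` verts G)"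

definition independent_set :: "('a, 'b) pre_digraph \<Rightarrow> 'a set \<Rightarrow> bool" where
  "independent_set G S \<longleftrightarrow> S \<subseteq> verts G \<and> (\<forall>u \<in> S. \<forall>v \<in> S. (u, v) \<notin> arcs_ends G)"

definition independence_number :: "('a, 'b) pre_digraph \<Rightarrow> nat" where
  "independence_number G = Max {card S | S. independent_set G S}"

definition k_connected :: "nat \<Rightarrow> ('a, 'b) pre_digraph \<Rightarrow> bool" where
  "k_connected k G \<longleftrightarrow> card (verts G) > k \<and>
     (\<forall>S. S \<subseteq> verts G \<and> card S < k \<longrightarrow>
        Digraph_Component.connected (G \<restriction> (verts G - S)))"

definition longest_path :: "('a, 'b) pre_digraph \<Rightarrow> 'a vwalk \<Rightarrow> bool" where
  "longest_path G p \<longleftrightarrow> vpath p G \<and> (\<forall>q. vpath q G \<longrightarrow> vwalk_length q \<le> vwalk_length p)"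

end

theory Submission
  imports Defs
begin

text \<open>Let \<open>p\<close> be a longest path, \<open>v\<close> a vertex off \<open>p\<close>, \<open>H\<close> the component of \<open>v\<close> in \<open>G - p\<close> and
  \<open>N\<close> the set of attachments, the vertices of \<open>p\<close> with a neighbour in \<open>H\<close>. By maximality of \<open>p\<close>, the
  first vertex of \<open>p\<close>, the successors on \<open>p\<close> of the attachments and any independent subset of \<open>H\<close> form
  together an independent set. As \<open>N\<close> separates \<open>H\<close> from that first vertex, it has at least \<open>k\<close>
  elements, so the bound \<open>k + 2\<close> on independent sets leaves no slack: \<open>N\<close> has exactly \<open>k\<close> elements and
  \<open>H\<close> is a clique (\<open>attachments_tight\<close>). Hence \<open>v\<close> has degree at most \<open>card H + k - 1\<close>, and it is
  enough to find a vertex of degree at least \<open>card H + 2\<close>. The attachment \<open>x\<close> met first on \<open>p\<close> is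
  such a vertex.

  To see this, cut \<open>p\<close> at the attachments into \<open>A x C\<close> when \<open>k = 1\<close> and into \<open>A x B y C\<close> when
  \<open>k = 2\<close>. Since \<open>H\<close> is a clique, a single path through all of \<open>H\<close> can take the place of any of the
  segments \<open>A\<close>, \<open>B\<close>, \<open>C\<close> (for \<open>B\<close>, 2-connectedness provides attaching edges with different
  ends in \<open>H\<close>, unless \<open>H\<close> is a single vertex), so each segment has at least \<open>card H\<close> vertices. Call a vertex a start of \<open>A\<close> if
  some path on exactly the vertices of \<open>A\<close> begins in it and ends in the last vertex of \<open>A\<close>. Replacing
  \<open>A\<close> by that path gives another longest path, so whatever holds for the first vertex of \<open>p\<close> holds
  for all starts. In particular no start is adjacent to the vertices of a suitable independent set of size
  \<open>k + 1\<close> outside \<open>A\<close>. The bound on independent sets then makes the starts a clique, and a rotation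
  argument (\<open>butlast_subset_starts\<close>) shows that every vertex of \<open>A\<close> but the last one is a start. The
  same holds for \<open>C\<close> reversed. It follows that there are no edges between different ones of the sets
  \<open>H\<close>, \<open>A\<close> without its last vertex, \<open>C\<close> without its first vertex and, for \<open>k = 2\<close>, \<open>B\<close>. These are
  \<open>k + 2\<close> sets. A non-neighbour of \<open>x\<close> in each of them would give, with \<open>x\<close> itself, an independent set of
  size \<open>k + 3\<close>. So \<open>x\<close> is adjacent to all of one of them. Together with the neighbours that \<open>x\<close>
  has in the other parts this gives degree at least \<open>card H + 2\<close>
  (\<open>degree_of_single_attachment\<close>, \<open>degree_of_double_attachment\<close>).\<close>

section \<open>Paths as vertex lists\<close>

context graph
begin

abbreviation adj :: "'a \<Rightarrow> 'a \<Rightarrow> bool" (infix \<open>\<sim>\<close> 50) where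
  "u \<sim> w \<equiv> (u, w) \<in> arcs_ends G"

lemma adj_commute: "u \<sim> w \<longleftrightarrow> w \<sim> u"
  using sym_arcs arcs_ends_symmetric by metis

lemma adj_sym: "u \<sim> w \<Longrightarrow> w \<sim> u"
  using sym_arcs arcs_ends_symmetric by metis

lemma adj_irrefl: "\<not> u \<sim> u"
  by (auto simp: arcs_ends_conv dest: no_loops)

lemma adj_verts: "u \<sim> w \<Longrightarrow> u \<in> verts G \<and> w \<in> verts G"
  by (auto simp: arcs_ends_conv)

lemma set_vwalk_arcs_subset_iff: "set (vwalk_arcs p) \<subseteq> arcs_ends G \<longleftrightarrow> successively (\<sim>) p"
  by (induction p rule: vwalk_arcs.induct) auto

lemma vpath_iff:
  "vpath p G \<longleftrightarrow> p \<noteq> [] \<and> distinct p \<and> set p \<subseteq> verts G \<and> successively (\<sim>) p"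
  unfolding vpath_def vwalk_def set_vwalk_arcs_subset_iff by auto

lemma vpath_singleton: "vpath [x] G \<longleftrightarrow> x \<in> verts G"
  by (simp add: vpath_iff)

lemma vpath_append:
  assumes "p \<noteq> []" "q \<noteq> []"
  shows "vpath (p @ q) G \<longleftrightarrow>
    vpath p G \<and> vpath q G \<and> last p \<sim> hd q \<and> set p \<inter> set q = {}"
  using assms by (auto simp: vpath_iff successively_append_iff)

lemma vpath_Cons:
  assumes "q \<noteq> []"
  shows "vpath (x # q) G \<longleftrightarrow> vpath q G \<and> x \<sim> hd q \<and> x \<notin> set q"
  using assms adj_verts by (auto simp: vpath_iff successively_Cons)

lemma vpath_rev: "vpath (rev p) G \<longleftrightarrow> vpath p G"
proof -
  have "(\<lambda>x y. y \<sim> x) = (\<sim>)" using adj_sym by blast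
  then have "successively (\<lambda>x y. y \<sim> x) p = successively (\<sim>) p" by (rule arg_cong)
  then show ?thesis by (simp add: vpath_iff)
qed

lemmas vpath_simps = vpath_append vpath_Cons vpath_rev vpath_singleton

text \<open>Normalising orientation of edges and of intersections lets the simplifier
  decide whether a rearrangement of pieces of a known path is again a path.\<close>

lemmas concat_simps = vpath_simps last_rev hd_rev adj_commute Int_Un_distrib Int_Un_distrib2 Int_commute

lemma longest_pathD: "longest_path G p \<Longrightarrow> vpath q G \<Longrightarrow> length q \<le> length p"
  unfolding longest_path_def by (cases p; cases q) (force simp: vpath_iff)+

lemma longest_path_same_set:
  assumes "longest_path G p" "vpath q G" "set q = set p"
  shows "longest_path G q"
proof -
  have "length q = length p"
    using assms by (metis longest_path_def vpath_def distinct_card)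
  then show ?thesis using assms by (simp add: longest_path_def)
qed

lemma out_degree_eq_card: "out_degree G u = card {w. u \<sim> w}"
proof -
  have "{w. u \<sim> w} = head G ` out_arcs G u"
    by (auto simp: arcs_ends_conv)
  moreover have "inj_on (head G) (out_arcs G u)"
    by (auto simp: inj_on_def arc_to_ends_def intro: no_multi_arcs)
  ultimately show ?thesis by (simp add: out_degree_def card_image)
qed

lemma finite_neighbours: "finite {w. u \<sim> w}"
  by (rule finite_subset[OF _ finite_verts]) (use adj_verts in blast)

section \<open>Independent sets and separators\<close>

lemma independent_set_insert:
  "independent_set G (insert w S) \<longleftrightarrow>
    independent_set G S \<and> w \<in> verts G \<and> (\<forall>s\<in>S. \<not> w \<sim> s)"
  unfolding independent_set_def using adj_sym adj_irrefl by blast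

lemma independent_set_empty: "independent_set G {}"
  by (simp add: independent_set_def)

lemma card_independent_set_le:
  assumes "independent_set G S"
  shows "card S \<le> independence_number G"
proof -
  have "{card S | S. independent_set G S} \<subseteq> {.. card (verts G)}"
    by (auto simp: independent_set_def intro: card_mono)
  then have "finite {card S | S. independent_set G S}"
    by (rule finite_subset) simp
  then show ?thesis
    unfolding independence_number_def using assms by (intro Max_ge) auto
qed

lemma k_connected_separator:
  assumes "k_connected k G" "S \<subseteq> verts G" "card S < k"
    and "u \<in> D" "u \<in> verts G - S" "w \<in> verts G - S" "w \<notin> D"
    and closed: "\<And>a b. a \<in> D \<Longrightarrow> a \<sim> b \<Longrightarrow> b \<in> D \<union> S"
  shows False
proof -
  let ?K = "G \<restriction> (verts G - S)"
  have "Digraph_Component.connected ?K"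
    using assms(1-3) by (simp add: k_connected_def)
  then have "(u, w) \<in> rtrancl_on (verts ?K) ((arcs_ends ?K)\<^sup>s)"
    using assms(5,6) by (auto simp: connected_conv)
  then have "w \<in> D"
  proof (induction rule: rtrancl_on_induct)
    case base
    show ?case using assms(4) by simp
  next
    case (step a b)
    then have "a \<sim> b" "b \<notin> S"
      using adj_sym by (auto simp: symcl_def arcs_ends_conv elim: converseE)
    then show ?case using closed step by blast
  qed
  then show False using assms(7) by simp
qed

section \<open>Rotating the initial segment of a path\<close>

definition starts :: "'a list \<Rightarrow> 'a set" where
  "starts A = {hd A' | A'. vpath A' G \<and> set A' = set A \<and> last A' = last A}"

lemma hd_in_starts: "vpath A G \<Longrightarrow> hd A \<in> starts A"
  by (auto simp: starts_def)

lemma startsE: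
  assumes "s \<in> starts A"
  obtains A' where "vpath A' G" "set A' = set A" "last A' = last A" "hd A' = s"
  using assms by (auto simp: starts_def)

lemma starts_subset: "starts A \<subseteq> set A"
proof
  fix s assume "s \<in> starts A"
  then obtain A' where "vpath A' G" "set A' = set A" "hd A' = s" by (rule startsE)
  then show "s \<in> set A" using hd_in_set by (metis vpath_iff)
qed

text \<open>If the first vertex of \<open>A\<close> is adjacent to the vertex at position \<open>j + 1\<close>,
  then reversing the first \<open>j + 1\<close> vertices makes the vertex at position \<open>j\<close> a start. So once the first
  vertex is adjacent to the last vertex and to all starts, each start found yields the one before it, and
  the starts sweep through \<open>A\<close> from its end to its beginning.\<close>

lemma butlast_subset_starts:
  assumes A: "vpath A G"
    and adj: "\<And>s. s \<in> insert (last A) (starts A) \<Longrightarrow> s \<noteq> hd A \<Longrightarrow> hd A \<sim> s"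
  shows "set (butlast A) \<subseteq> starts A"
proof -
  have ne: "A \<noteq> []" and dist: "distinct A" using A by (auto simp: vpath_iff)
  have start: "A ! j \<in> starts A" if "Suc j < length A" "hd A \<sim> A ! Suc j" for j
  proof -
    define X Y where "X = take (Suc j) A" and "Y = drop (Suc j) A"
    have XY: "A = X @ Y" "X \<noteq> []" "Y \<noteq> []" using that by (auto simp: X_def Y_def)
    have "hd Y = A ! Suc j" using that by (simp add: Y_def hd_drop_conv_nth)
    moreover have "last X = A ! j" using that by (simp add: X_def take_Suc_conv_app_nth)
    moreover have "hd X = hd A" using XY by (metis hd_append2)
    ultimately have "vpath (rev X @ Y) G" "hd (rev X @ Y) = A ! j"
      using that A XY by (auto simp: vpath_simps last_rev hd_rev)
    then show ?thesis
      unfolding starts_def using XY by (intro CollectI exI[of _ "rev X @ Y"]) auto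
  qed
  have all: "hd A \<sim> A ! Suc j" if "Suc j < length A" for j
  proof -
    have "Suc j \<le> length A - 1" using that by simp
    then show ?thesis using that
    proof (induction rule: inc_induct)
      case base
      have "A ! (length A - 1) = last A" using ne by (simp add: last_conv_nth)
      moreover have "last A \<noteq> hd A"
        using dist that ne by (simp add: last_conv_nth hd_conv_nth nth_eq_iff_index_eq)
      ultimately show ?case using adj by simp
    next
      case (step n)
      then have "A ! n \<in> starts A" using start by simp
      moreover have "A ! n \<noteq> hd A"
        using dist step ne by (simp add: hd_conv_nth nth_eq_iff_index_eq)
      ultimately show ?case using adj by simp
    qed
  qed
  show ?thesis
  proof
    fix a assume "a \<in> set (butlast A)"
    then obtain j where "j < length A - 1" "a = A ! j"
      by (metis in_set_conv_nth length_butlast nth_butlast)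
    then show "a \<in> starts A" using start all by auto
  qed
qed

text \<open>The adjacencies required above come for free if \<open>J\<close> is an independent set
  that cannot be enlarged by two vertices: two non-adjacent vertices without neighbours in \<open>J\<close> would enlarge it.\<close>

lemma butlast_subset_starts_if_independent:
  assumes A: "vpath A G" and J: "independent_set G J"
    and bound: "\<And>S. independent_set G S \<Longrightarrow> card S < card J + 2"
    and sep: "\<And>s z. s \<in> insert (last A) (starts A) \<Longrightarrow> z \<in> J \<Longrightarrow> \<not> s \<sim> z"
    and disj: "set A \<inter> J = {}"
  shows "set (butlast A) \<subseteq> starts A"
proof (rule butlast_subset_starts[OF A])
  fix s assume s: "s \<in> insert (last A) (starts A)" "s \<noteq> hd A"
  have ne: "A \<noteq> []" using A by (simp add: vpath_iff)
  have sA: "s \<in> set A" "hd A \<in> set A"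
    using s ne starts_subset by auto
  have fin: "finite J" using J finite_subset[OF _ finite_verts] by (auto simp: independent_set_def)
  show "hd A \<sim> s"
  proof (rule ccontr)
    assume "\<not> hd A \<sim> s"
    then have "independent_set G (insert (hd A) (insert s J))"
      using J sep s hd_in_starts[OF A] sA A by (auto simp: independent_set_insert vpath_iff)
    moreover have "card (insert (hd A) (insert s J)) = card J + 2"
      using fin disj sA s by (subst card_insert_disjoint; auto)+
    ultimately show False using bound by force
  qed
qed

section \<open>Longest paths with a detour at the end of a segment\<close>

text \<open>\<open>A\<close> and \<open>C\<close> are the end segments of a longest path, \<open>T\<close> is the part from the first to the last
  attachment, and \<open>H\<close> is a set off the path such that, next to either end of \<open>T\<close>, some path begins that
  visits exactly \<open>H\<close>. This form covers one attachment (\<open>T\<close> a single vertex) and two attachments, and it is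
  preserved under reversal and under rearranging \<open>A\<close>.\<close>

definition hooked :: "'a list \<Rightarrow> 'a list \<Rightarrow> 'a list \<Rightarrow> 'a set \<Rightarrow> bool" where
  "hooked A T C H \<longleftrightarrow> A \<noteq> [] \<and> T \<noteq> [] \<and> C \<noteq> [] \<and> longest_path G (A @ T @ C)
    \<and> set (A @ T @ C) \<inter> H = {}
    \<and> (\<exists>q. vpath q G \<and> set q = H \<and> last q \<sim> hd T)
    \<and> (\<exists>q. vpath q G \<and> set q = H \<and> hd q \<sim> last T)"

lemma hooked_rev:
  assumes "hooked A T C H"
  shows "hooked (rev C) (rev T) (rev A) H"
proof -
  have "longest_path G (rev (A @ T @ C))"
    by (rule longest_path_same_set[of "A @ T @ C"])
       (use assms in \<open>auto simp: hooked_def vpath_rev longest_path_def simp del: rev_append\<close>)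
  moreover obtain q q' where q: "vpath q G" "set q = H" "last q \<sim> hd T"
    and q': "vpath q' G" "set q' = H" "hd q' \<sim> last T"
    using assms unfolding hooked_def by blast
  have "\<exists>q. vpath q G \<and> set q = H \<and> last q \<sim> hd (rev T)"
    using q' by (intro exI[of _ "rev q'"]) (simp add: vpath_rev last_rev hd_rev)
  moreover have "\<exists>q. vpath q G \<and> set q = H \<and> hd q \<sim> last (rev T)"
    using q by (intro exI[of _ "rev q"]) (simp add: vpath_rev last_rev hd_rev)
  moreover have "set (rev C @ rev T @ rev A) \<inter> H = {}"
    using assms by (auto simp: hooked_def)
  ultimately show ?thesis
    using assms by (simp add: hooked_def)
qed

lemma hooked_replace:
  assumes "hooked A T C H" "vpath A' G" "set A' = set A" "last A' = last A"
  shows "hooked A' T C H"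
proof -
  have "longest_path G (A' @ T @ C)"
    by (rule longest_path_same_set[of "A @ T @ C"])
       (use assms in \<open>auto simp: hooked_def vpath_simps longest_path_def vpath_iff[of A']\<close>)
  then show ?thesis using assms by (auto simp: hooked_def vpath_iff)
qed

text \<open>Each forbidden edge would allow a path through \<open>A\<close>, \<open>T\<close> and \<open>C\<close> that in
  addition sweeps through \<open>H\<close>: in the first two cases one walks through \<open>C\<close>, crosses the edge to the
  beginning of \<open>A\<close> and leaves \<open>T\<close> into \<open>H\<close> where \<open>C\<close> used to follow. The third is the second one
  for the reversed path.\<close>

lemma hooked_end_nonadjacent:
  assumes "hooked A T C H"
  shows "\<not> hd A \<sim> hd C" "\<not> hd A \<sim> last C" "\<not> last A \<sim> last C"
proof -
  have 1: "\<not> hd A \<sim> hd C \<and> \<not> hd A \<sim> last C" if hk: "hooked A T C H" for A T C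
  proof -
    obtain q q' where q: "vpath q G" "set q = H" "last q \<sim> hd T"
      and q': "vpath q' G" "set q' = H" "hd q' \<sim> last T"
      and ne: "A \<noteq> []" "T \<noteq> []" "C \<noteq> []" and lp: "longest_path G (A @ T @ C)"
      and disj: "set (A @ T @ C) \<inter> H = {}"
      using hk by (auto simp: hooked_def)
    have qne: "q \<noteq> []" "q' \<noteq> []" using q q' by (auto simp: vpath_iff)
    have p: "vpath (A @ T @ C) G" using lp by (simp add: longest_path_def)
    have "\<not> hd A \<sim> hd C"
    proof
      assume "hd A \<sim> hd C"
      then have "vpath (rev C @ A @ T @ q') G"
        using p ne qne q' disj by (simp add: concat_simps)
      from longest_pathD[OF lp this] show False using qne by simp
    qed
    moreover have "\<not> hd A \<sim> last C"
    proof
      assume "hd A \<sim> last C"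
      then have "vpath (rev q' @ rev T @ rev A @ rev C) G"
        using p ne qne q' disj
        by (simp add: concat_simps)
      from longest_pathD[OF lp this] show False using qne by simp
    qed
    ultimately show ?thesis by simp
  qed
  show "\<not> hd A \<sim> hd C" "\<not> hd A \<sim> last C" using 1[OF assms] by auto
  show "\<not> last A \<sim> last C"
    using 1[OF hooked_rev[OF assms]] by (simp add: hd_rev adj_commute)
qed


lemma hooked_vpath: "hooked A T C H \<Longrightarrow> vpath (A @ T @ C) G"
  by (simp add: hooked_def longest_path_def)

lemma hooked_vpath_left: "hooked A T C H \<Longrightarrow> vpath A G"
  using hooked_vpath[of A T C H] by (simp add: hooked_def vpath_append)

lemma hooked_vpath_right: "hooked A T C H \<Longrightarrow> vpath C G"
  using hooked_vpath[of A T C H] by (simp add: hooked_def vpath_append)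

text \<open>Rearranging both end segments makes \<open>s\<close> and \<open>t\<close> the two ends of a longest path.\<close>

lemma hooked_starts_nonadjacent:
  assumes "hooked A T C H" "s \<in> starts A" "t \<in> starts (rev C)"
  shows "\<not> s \<sim> t"
proof -
  obtain A' where A': "vpath A' G" "set A' = set A" "last A' = last A" "hd A' = s"
    using assms(2) by (rule startsE)
  obtain C' where C': "vpath C' G" "set C' = set (rev C)" "last C' = last (rev C)" "hd C' = t"
    using assms(3) by (rule startsE)
  have "hooked (rev C) (rev T) (rev A') H"
    using hooked_rev[OF hooked_replace[OF assms(1) A'(1-3)]] .
  from hooked_end_nonadjacent(2)[OF hooked_replace[OF this C'(1-3)]]
  show ?thesis using A'(4) C'(4) by (simp add: last_rev adj_commute)
qed

lemma last_in_starts_rev: "vpath C G \<Longrightarrow> last C \<in> starts (rev C)"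
  using hd_in_starts[of "rev C"] by (simp add: vpath_rev hd_rev)

lemma hooked_starts_last_nonadjacent:
  assumes "hooked A T C H" "s \<in> insert (last A) (starts A)"
  shows "\<not> s \<sim> last C"
  using assms hooked_end_nonadjacent(3)[OF assms(1)]
    hooked_starts_nonadjacent[OF assms(1)] last_in_starts_rev[OF hooked_vpath_right[OF assms(1)]]
  by blast

text \<open>Otherwise a sweep through \<open>H\<close> in place of \<open>A\<close> would lengthen the path.\<close>

lemma hooked_card_le:
  assumes "hooked A T C H"
  shows "card H \<le> card (set A)"
proof -
  obtain q where q: "vpath q G" "set q = H" "last q \<sim> hd T"
    and ne: "A \<noteq> []" "T \<noteq> []" "C \<noteq> []" and lp: "longest_path G (A @ T @ C)"
    and disj: "set (A @ T @ C) \<inter> H = {}"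
    using assms unfolding hooked_def by blast
  have qne: "q \<noteq> []" using q by (simp add: vpath_iff)
  have p: "vpath (A @ T @ C) G" using lp by (simp add: longest_path_def)
  have "vpath (q @ T @ C) G"
    using p ne qne q disj by (simp add: concat_simps)
  from longest_pathD[OF lp this] have "length q \<le> length A" by simp
  then show ?thesis
    using q hooked_vpath_left[OF assms] by (metis vpath_iff distinct_card)
qed

lemma hooked_detour:
  assumes "hooked A T C H"
  shows "H \<noteq> {}" "finite H" "H \<subseteq> verts G"
  using assms by (auto simp: hooked_def vpath_iff)

lemma card_neighbours_ge:
  assumes "\<And>w. w \<in> X \<Longrightarrow> x \<sim> w" "x \<sim> u" "x \<sim> w" "u \<notin> X" "w \<notin> X" "u \<noteq> w" "m \<le> card X"
  shows "m + 2 \<le> card {w. x \<sim> w}"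
proof -
  have fin: "finite X" by (rule finite_subset[OF _ finite_neighbours[of x]]) (use assms in blast)
  have "card X + 2 = card (insert u (insert w X))" using fin assms by simp
  also have "\<dots> \<le> card {w. x \<sim> w}"
    by (rule card_mono[OF finite_neighbours]) (use assms in blast)
  finally show ?thesis using assms(7) by simp
qed

lemma last_or_butlast: "a \<in> set A \<Longrightarrow> a = last A \<or> a \<in> set (butlast A)"
  by (metis append_butlast_last_id empty_iff empty_set in_set_conv_decomp rotate1.simps(2) set_ConsD set_rotate1)

lemma butlast_rev_eq: "butlast (rev C) = rev (tl C)"
  by (cases C) auto

section \<open>One attachment\<close>

text \<open>Here the vertices of \<open>H\<close>, of \<open>A\<close> but the last and of \<open>C\<close> but the first are
  pairwise separated, so the bound on independent sets forces \<open>x\<close> to be adjacent to all of \<open>H\<close>, \<open>A\<close>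
  or \<open>C\<close>. That set has at least \<open>card H\<close> elements, and \<open>x\<close> has a further neighbour in each of the
  other two.\<close>

lemma degree_of_single_attachment:
  assumes hk: "hooked A [x] C H"
    and sep: "\<And>h w. h \<in> H \<Longrightarrow> w \<in> set A \<union> set C \<Longrightarrow> \<not> h \<sim> w"
    and bound: "\<And>S. independent_set G S \<Longrightarrow> card S < 4"
  shows "card H + 2 \<le> card {w. x \<sim> w}"
proof -
  have left: "set (butlast A) \<subseteq> starts A"
    if hk: "hooked A [x] C H" and sep: "\<And>h w. h \<in> H \<Longrightarrow> w \<in> set A \<union> set C \<Longrightarrow> \<not> h \<sim> w"
    for A C
  proof -
    obtain h where h: "h \<in> H" "h \<in> verts G" using hooked_detour[OF hk] by blast
    have ne: "A \<noteq> []" "C \<noteq> []" and disj: "set A \<inter> H = {}" "set C \<inter> H = {}" "x \<notin> H"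
      using hk by (auto simp: hooked_def Int_Un_distrib2)
    have AC: "set A \<inter> set C = {}" and C: "last C \<in> set C" "last C \<in> verts G"
      using hooked_vpath[OF hk] ne by (auto simp: vpath_iff)
    have A: "insert (last A) (starts A) \<subseteq> set A" using starts_subset ne by auto
    \<comment> \<open>No vertex that starts or ends a rearrangement of \<open>A\<close> has a neighbour in this set, and
      the bound on independent sets leaves room for one more vertex only.\<close>
    have J: "independent_set G {h, last C}"
      using h C sep by (auto simp: independent_set_insert independent_set_empty)
    have "h \<noteq> last C" using C h disj by blast
    then have card: "card {h, last C} = 2" by simp
    show ?thesis
    proof (rule butlast_subset_starts_if_independent[OF hooked_vpath_left[OF hk] J])
      show "card S < card {h, last C} + 2" if "independent_set G S" for S
        using bound[OF that] card by simp
      show "\<not> s \<sim> z" if "s \<in> insert (last A) (starts A)" "z \<in> {h, last C}" for s z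
        using that A h sep[of h s] hooked_starts_last_nonadjacent[OF hk, of s]
        by (auto simp: adj_commute)
      show "set A \<inter> {h, last C} = {}" using AC C h disj by auto
    qed
  qed
  have A: "set (butlast A) \<subseteq> starts A" by (rule left[OF hk sep])
  have "set (butlast (rev C)) \<subseteq> starts (rev C)"
    by (rule left) (use hooked_rev[OF hk] sep in auto)
  then have C: "set (tl C) \<subseteq> starts (rev C)" by (simp add: butlast_rev_eq)
  have ne: "A \<noteq> []" "C \<noteq> []" and disj: "set A \<inter> H = {}" "set C \<inter> H = {}" "x \<notin> H"
    using hk by (auto simp: hooked_def Int_Un_distrib2)
  obtain q where q: "set q = H" "hd q \<sim> x" "vpath q G" using hk by (auto simp: hooked_def)
  have p: "vpath (A @ [x] @ C) G" by (rule hooked_vpath[OF hk])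
  have xa: "x \<sim> last A" and xc: "x \<sim> hd C" and xh: "x \<sim> hd q" and hq: "hd q \<in> H"
    using p ne q by (auto simp: vpath_simps vpath_iff[of q] adj_commute)
  have mem: "last A \<in> set A" "hd C \<in> set C" using ne by auto
  have AC: "set A \<inter> set C = {}" "x \<notin> set A" "x \<notin> set C"
    and verts: "set A \<subseteq> verts G" "set C \<subseteq> verts G" "x \<in> verts G"
    using p by (auto simp: vpath_iff)
  have cA: "card H \<le> card (set A)" by (rule hooked_card_le[OF hk])
  have cC: "card H \<le> card (set C)" using hooked_card_le[OF hooked_rev[OF hk]] by simp
  have "(\<forall>h\<in>H. x \<sim> h) \<or> (\<forall>a\<in>set A. x \<sim> a) \<or> (\<forall>c\<in>set C. x \<sim> c)"
  proof (rule ccontr)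
    assume "\<not> ?thesis"
    then obtain h a c where hac: "h \<in> H" "\<not> x \<sim> h" "a \<in> set A" "\<not> x \<sim> a" "c \<in> set C" "\<not> x \<sim> c"
      by blast
    have "a \<noteq> last A" "c \<noteq> hd C" using hac xa xc by metis+
    then have "a \<in> set (butlast A)" using last_or_butlast[OF hac(3)] by simp
    moreover have "c \<in> set (tl C)" using hac(5) \<open>c \<noteq> hd C\<close> by (cases C) auto
    ultimately have "a \<in> starts A" "c \<in> starts (rev C)" using A C by blast+
    then have "\<not> a \<sim> c" by (rule hooked_starts_nonadjacent[OF hk])
    have "independent_set G {x, h, a, c}"
    proof -
      have "\<not> h \<sim> a" "\<not> h \<sim> c" using sep[OF hac(1)] hac by blast+
      moreover have "h \<in> verts G" "a \<in> verts G" "c \<in> verts G"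
        using hac verts hooked_detour(3)[OF hk] by blast+
      ultimately show ?thesis
        using hac verts(3) \<open>\<not> a \<sim> c\<close> by (simp add: independent_set_insert independent_set_empty)
    qed
    moreover have "card {x, h, a, c} = 4"
    proof -
      have "x \<noteq> h" "x \<noteq> a" "x \<noteq> c" "h \<noteq> a" "h \<noteq> c" "a \<noteq> c"
        using hac AC disj by (metis disjoint_iff)+
      then show ?thesis by simp
    qed
    ultimately show False using bound by force
  qed
  then show ?thesis
  proof (elim disjE)
    assume "\<forall>h\<in>H. x \<sim> h"
    then show ?thesis
      by (intro card_neighbours_ge[of H x "last A" "hd C"]) (use xa xc mem AC disj in auto)
  next
    assume "\<forall>a\<in>set A. x \<sim> a"
    then show ?thesis
      by (intro card_neighbours_ge[of "set A" x "hd q" "hd C"]) (use xh xc mem AC disj hq cA in auto)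
  next
    assume "\<forall>c\<in>set C. x \<sim> c"
    then show ?thesis
      by (intro card_neighbours_ge[of "set C" x "hd q" "last A"]) (use xh xa mem AC disj hq cC in auto)
  qed
qed

section \<open>Two attachments\<close>

text \<open>In addition to the detours at the ends of \<open>T\<close>, a path sweeping through \<open>H\<close> may now lead from
  \<open>x\<close> to \<open>y\<close>, and thus replace the middle segment \<open>B\<close>.\<close>

definition crossed :: "'a list \<Rightarrow> 'a \<Rightarrow> 'a list \<Rightarrow> 'a \<Rightarrow> 'a list \<Rightarrow> 'a set \<Rightarrow> bool" where
  "crossed A x B y C H \<longleftrightarrow> hooked A (x # B @ [y]) C H \<and> B \<noteq> []
    \<and> (\<exists>q. vpath q G \<and> set q = H \<and> hd q \<sim> x \<and> last q \<sim> y)"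

lemma crossed_rev:
  assumes "crossed A x B y C H"
  shows "crossed (rev C) y (rev B) x (rev A) H"
proof -
  obtain q where "vpath q G" "set q = H" "hd q \<sim> x" "last q \<sim> y"
    using assms by (auto simp: crossed_def)
  then have "\<exists>q. vpath q G \<and> set q = H \<and> hd q \<sim> y \<and> last q \<sim> x"
    by (intro exI[of _ "rev q"]) (simp add: vpath_rev hd_rev last_rev)
  then show ?thesis
    using assms hooked_rev[of A "x # B @ [y]" C H] by (simp add: crossed_def)
qed

lemma crossed_paths:
  assumes "crossed A x B y C H"
  obtains q where "hooked A (x # B @ [y]) C H"
    "A \<noteq> []" "B \<noteq> []" "C \<noteq> []" "q \<noteq> []" "set q = H" "vpath q G" "hd q \<sim> x" "last q \<sim> y"
    "longest_path G (A @ x # B @ y # C)" "vpath (A @ x # B @ y # C) G"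
    "set (A @ x # B @ y # C) \<inter> set q = {}"
proof -
  obtain q where "vpath q G" "set q = H" "hd q \<sim> x" "last q \<sim> y"
    using assms by (auto simp: crossed_def)
  then show ?thesis
    using that[of q] assms by (auto simp: crossed_def hooked_def longest_path_def vpath_iff[of q])
qed

text \<open>From \<open>C\<close> one can go through \<open>y\<close>, \<open>H\<close>, \<open>x\<close> and \<open>A\<close> to the start \<open>s\<close>, and
  an edge from there would add all of \<open>B\<close>. As the statement allows any path on the vertices of \<open>B\<close>, it
  yields, once \<open>B\<close> is known to be cyclic, that no start of \<open>A\<close> has a neighbour in \<open>B\<close>.\<close>

lemma crossed_starts_nonadjacent_middle:
  assumes cr: "crossed A x B y C H" and s: "s \<in> starts A"
    and B': "vpath B' G" "set B' = set B"
  shows "\<not> s \<sim> hd B'"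
proof
  assume adj: "s \<sim> hd B'"
  obtain A' where A': "vpath A' G" "set A' = set A" "last A' = last A" "hd A' = s"
    using s by (rule startsE)
  have "crossed A' x B y C H"
    using cr hooked_replace[OF _ A'(1-3)] by (simp add: crossed_def)
  then obtain q where ne: "A' \<noteq> []" "B \<noteq> []" "C \<noteq> []" "q \<noteq> []"
    and q: "vpath q G" "hd q \<sim> x" "last q \<sim> y"
    and lp: "longest_path G (A' @ x # B @ y # C)" and p: "vpath (A' @ x # B @ y # C) G"
    and disj: "set (A' @ x # B @ y # C) \<inter> set q = {}"
    by (rule crossed_paths)
  have "B' \<noteq> []" using B' by (simp add: vpath_iff)
  moreover have "y \<noteq> x" using p by (auto simp: vpath_iff)
  ultimately have "vpath (rev C @ [y] @ rev q @ [x] @ rev A' @ B') G"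
    using p ne q disj adj A' B' by (simp add: concat_simps)
  from longest_pathD[OF lp this] have "length q + length B' \<le> length B" by simp
  moreover have "distinct B" "distinct B'" using p B' by (auto simp: vpath_iff)
  then have "length B' = length B" using B'(2) by (metis distinct_card)
  ultimately show False using ne by simp
qed

text \<open>The edge would give the longer path \<open>A\<close>, reversed \<open>B\<close>, \<open>x\<close>, \<open>H\<close>, \<open>y\<close>, \<open>C\<close>.\<close>

lemma crossed_lasts_nonadjacent:
  assumes cr: "crossed A x B y C H"
  shows "\<not> last A \<sim> last B"
proof
  assume adj: "last A \<sim> last B"
  obtain q where ne: "A \<noteq> []" "B \<noteq> []" "C \<noteq> []" "q \<noteq> []"
    and q: "vpath q G" "hd q \<sim> x" "last q \<sim> y"
    and lp: "longest_path G (A @ x # B @ y # C)" and p: "vpath (A @ x # B @ y # C) G"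
    and disj: "set (A @ x # B @ y # C) \<inter> set q = {}"
    using cr by (rule crossed_paths)
  have "vpath (A @ rev B @ [x] @ q @ [y] @ C) G"
    using p ne q disj adj by (simp add: concat_simps)
  from longest_pathD[OF lp this] show False using ne by simp
qed

lemma crossed_card_le:
  assumes cr: "crossed A x B y C H"
  shows "card H \<le> card (set B)"
proof -
  obtain q where ne: "A \<noteq> []" "B \<noteq> []" "C \<noteq> []" "q \<noteq> []"
    and q: "vpath q G" "hd q \<sim> x" "last q \<sim> y" "set q = H"
    and lp: "longest_path G (A @ x # B @ y # C)" and p: "vpath (A @ x # B @ y # C) G"
    and disj: "set (A @ x # B @ y # C) \<inter> set q = {}"
    using cr by (rule crossed_paths)
  have "vpath (A @ [x] @ q @ [y] @ C) G"
    using p ne q disj by (simp add: concat_simps)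
  from longest_pathD[OF lp this] have "length q \<le> length B" by simp
  moreover have "distinct B" "distinct q" using p q(1) by (auto simp: vpath_iff)
  ultimately show ?thesis using q(4) by (metis distinct_card)
qed

lemma cyclic_start:
  assumes "vpath B G" "hd B = last B \<or> hd B \<sim> last B" "b \<in> set B"
  obtains B' where "vpath B' G" "set B' = set B" "hd B' = b"
proof (cases "hd B = b")
  case True
  then show ?thesis using that[of B] assms by simp
next
  case False
  obtain X Y where B: "B = X @ b # Y" using assms(3) by (meson split_list)
  then have X: "X \<noteq> []" using False by auto
  have "hd B \<noteq> last B"
  proof -
    have "hd B = hd X" "last B = last (b # Y)" using B X by simp_all
    moreover have "distinct (X @ b # Y)" using B assms(1) by (simp add: vpath_iff)
    ultimately show ?thesis
      using hd_in_set[OF X] last_in_set[of "b # Y"] by (metis disjoint_iff distinct_append list.distinct(1))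
  qed
  then have "last (b # Y) \<sim> hd X" using assms(2) B X by (simp add: adj_commute)
  then have "vpath ((b # Y) @ X) G"
    using assms(1) B X vpath_append[of X "b # Y"] vpath_append[of "b # Y" X] by auto
  then show ?thesis using that[of "(b # Y) @ X"] B by auto
qed


text \<open>As for one attachment, but the middle segment \<open>B\<close> provides the fifth
  vertex of the independent sets. First it must be shown that \<open>B\<close> is cyclic, so that every vertex
  of \<open>B\<close> begins a path on the vertices of \<open>B\<close>.\<close>

lemma degree_of_double_attachment:
  assumes cr: "crossed A x B y C H"
    and sep: "\<And>h w. h \<in> H \<Longrightarrow> w \<in> set A \<union> set B \<union> set C \<Longrightarrow> \<not> h \<sim> w"
    and bound: "\<And>S. independent_set G S \<Longrightarrow> card S < 5"
  shows "card H + 2 \<le> card {w. x \<sim> w}"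
proof -
  have left: "set (butlast A) \<subseteq> starts A \<and> (\<forall>s\<in>starts A. \<forall>b\<in>set B. \<not> s \<sim> b)"
    if cr: "crossed A x B y C H"
      and sep: "\<And>h w. h \<in> H \<Longrightarrow> w \<in> set A \<union> set B \<union> set C \<Longrightarrow> \<not> h \<sim> w"
    for A x B y C
  proof -
    obtain q where hk: "hooked A (x # B @ [y]) C H"
      and ne: "A \<noteq> []" "B \<noteq> []" "C \<noteq> []" "q \<noteq> []"
      and q: "set q = H" and p: "vpath (A @ x # B @ y # C) G"
      and disj: "set (A @ x # B @ y # C) \<inter> set q = {}"
      using cr by (rule crossed_paths)
    obtain h where h: "h \<in> H" "h \<in> verts G" using hooked_detour[OF hk] by blast
    have B: "vpath B G" using p ne by (simp add: vpath_simps)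
    have A: "insert (last A) (starts A) \<subseteq> set A" "hd A \<in> starts A"
      using starts_subset ne hd_in_starts[OF hooked_vpath_left[OF hk]] by auto
    have mem: "hd A \<in> set A" "hd B \<in> set B" "last B \<in> set B" "last C \<in> set C" using ne by auto
    have inter: "set A \<inter> set B = {}" "set A \<inter> set C = {}" "set B \<inter> set C = {}"
      "set A \<inter> H = {}" "set B \<inter> H = {}" "set C \<inter> H = {}"
      using p disj q by (auto simp: vpath_iff)
    have verts: "set A \<subseteq> verts G" "set B \<subseteq> verts G" "set C \<subseteq> verts G"
      using p by (auto simp: vpath_iff)
    have starts_B: "\<not> s \<sim> hd B'" if "s \<in> starts A" "vpath B' G" "set B' = set B" for s B'
      using crossed_starts_nonadjacent_middle[OF cr that] .
    have last_B: "\<not> s \<sim> last B" if "s \<in> insert (last A) (starts A)" for s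
      using that crossed_lasts_nonadjacent[OF cr] starts_B[of s "rev B"] B
      by (auto simp: vpath_rev hd_rev)
    have last_C: "\<not> s \<sim> last C" if "s \<in> insert (last A) (starts A)" for s
      by (rule hooked_starts_last_nonadjacent[OF hk that])
    have C_B: "\<not> last C \<sim> hd B'" if "vpath B' G" "set B' = set B" for B'
      by (rule crossed_starts_nonadjacent_middle[OF crossed_rev[OF cr]])
         (use that last_in_starts_rev[OF hooked_vpath_right[OF hk]] in auto)
    have C_last_B: "\<not> last C \<sim> last B"
      using C_B[of "rev B"] B by (simp add: vpath_rev hd_rev)
    \<comment> \<open>The ends of \<open>B\<close> have no neighbours in \<open>H\<close> or among the ends of
      the path, so they are equal or adjacent, or else the five vertices would be independent.\<close>
    have "hd B = last B \<or> hd B \<sim> last B"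
    proof (rule ccontr)
      assume B12: "\<not> ?thesis"
      have "independent_set G {h, hd A, last C, hd B, last B}"
      proof -
        have "\<not> h \<sim> hd A" "\<not> h \<sim> last C" "\<not> h \<sim> hd B" "\<not> h \<sim> last B"
          using sep[OF h(1)] mem by blast+
        moreover have "\<not> hd A \<sim> last C" "\<not> hd A \<sim> hd B" "\<not> hd A \<sim> last B"
          using last_C last_B starts_B[OF _ B refl] A(2) by blast+
        moreover have "hd A \<in> verts G" "last C \<in> verts G" "hd B \<in> verts G" "last B \<in> verts G"
          using mem verts by blast+
        ultimately show ?thesis
          using h(2) B12 C_B[OF B refl] C_last_B
          by (simp add: independent_set_insert independent_set_empty)
      qed
      moreover have "card {h, hd A, last C, hd B, last B} = 5"
      proof -
        have "h \<noteq> hd A" "h \<noteq> last C" "h \<noteq> hd B" "h \<noteq> last B" "hd A \<noteq> last C" "hd A \<noteq> hd B"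
          "hd A \<noteq> last B" "last C \<noteq> hd B" "last C \<noteq> last B"
          using h(1) mem inter by (metis disjoint_iff)+
        then show ?thesis using B12 by simp
      qed
      ultimately show False using bound by force
    qed
    then have AB: "\<not> s \<sim> b" if "s \<in> starts A" "b \<in> set B" for s b
      using cyclic_start[OF B _ that(2)] starts_B[OF that(1)] by metis
    \<comment> \<open>For the last vertex of \<open>A\<close> it matters that this set contains \<open>last B\<close>: an edge between
      \<open>last A\<close> and \<open>hd B\<close> is not excluded.\<close>
    have J: "independent_set G {h, last C, last B}"
    proof -
      have "\<not> h \<sim> last C" "\<not> h \<sim> last B" using sep[OF h(1)] mem by blast+
      moreover have "last C \<in> verts G" "last B \<in> verts G" using mem verts by blast+
      ultimately show ?thesis
        using h(2) C_last_B by (simp add: independent_set_insert independent_set_empty)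
    qed
    have "h \<noteq> last C" "h \<noteq> last B" "last C \<noteq> last B"
      using h(1) mem inter by (metis disjoint_iff)+
    then have card: "card {h, last C, last B} = 3" by simp
    have "set (butlast A) \<subseteq> starts A"
    proof (rule butlast_subset_starts_if_independent[OF hooked_vpath_left[OF hk] J])
      show "card S < card {h, last C, last B} + 2" if "independent_set G S" for S
        using bound[OF that] card by simp
      show "\<not> s \<sim> z" if "s \<in> insert (last A) (starts A)" "z \<in> {h, last C, last B}" for s z
        using that A(1) h sep[of h s] last_C[of s] last_B[of s] by (auto simp: adj_commute)
      show "set A \<inter> {h, last C, last B} = {}" using inter mem h(1) by (simp add: disjoint_iff) metis
    qed
    then show ?thesis using AB by blast
  qed
  have "set (butlast A) \<subseteq> starts A \<and> (\<forall>s\<in>starts A. \<forall>b\<in>set B. \<not> s \<sim> b)"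
    by (rule left[OF cr sep])
  then have A: "set (butlast A) \<subseteq> starts A"
    "\<And>s b. s \<in> starts A \<Longrightarrow> b \<in> set B \<Longrightarrow> \<not> s \<sim> b"
    by simp_all
  have "set (butlast (rev C)) \<subseteq> starts (rev C) \<and>
    (\<forall>s\<in>starts (rev C). \<forall>b\<in>set (rev B). \<not> s \<sim> b)"
    by (rule left[OF crossed_rev[OF cr]]) (use sep in auto)
  then have C: "set (tl C) \<subseteq> starts (rev C)"
    "\<And>s b. s \<in> starts (rev C) \<Longrightarrow> b \<in> set B \<Longrightarrow> \<not> b \<sim> s"
    using adj_sym by (simp_all add: butlast_rev_eq) blast
  obtain q where hk: "hooked A (x # B @ [y]) C H"
    and ne: "A \<noteq> []" "B \<noteq> []" "C \<noteq> []" "q \<noteq> []"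
    and q: "set q = H" "hd q \<sim> x" and p: "vpath (A @ x # B @ y # C) G"
    and disj: "set (A @ x # B @ y # C) \<inter> set q = {}"
    using cr by (rule crossed_paths)
  have xa: "x \<sim> last A" and xb: "x \<sim> hd B" and xh: "x \<sim> hd q"
    using p ne q(2) by (simp_all add: vpath_simps adj_commute)
  have mem: "last A \<in> set A" "hd B \<in> set B" "hd q \<in> H" using ne q by auto
  have inter: "set A \<inter> set B = {}" "set A \<inter> set C = {}" "set B \<inter> set C = {}"
      "set A \<inter> H = {}" "set B \<inter> H = {}" "set C \<inter> H = {}"
    and x: "x \<notin> set A" "x \<notin> set B" "x \<notin> set C" "x \<notin> H"
    and verts: "set A \<subseteq> verts G" "set B \<subseteq> verts G" "set C \<subseteq> verts G" "x \<in> verts G"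
    using p disj q by (auto simp: vpath_iff)
  have cA: "card H \<le> card (set A)" by (rule hooked_card_le[OF hk])
  have cB: "card H \<le> card (set B)" by (rule crossed_card_le[OF cr])
  have "distinct C" using p by (simp add: vpath_iff)
  then have cC: "card H \<le> Suc (card (set (tl C)))"
    using hooked_card_le[OF hooked_rev[OF hk]] ne by (simp add: distinct_card distinct_tl)
  have tlC: "set (tl C) \<subseteq> set C" by (cases C) auto
  have "(\<forall>h\<in>H. x \<sim> h) \<or> (\<forall>a\<in>set A. x \<sim> a) \<or> (\<forall>b\<in>set B. x \<sim> b) \<or> (\<forall>c\<in>set (tl C). x \<sim> c)"
  proof (rule ccontr)
    assume "\<not> ?thesis"
    then obtain h a b c where w: "h \<in> H" "\<not> x \<sim> h" "a \<in> set A" "\<not> x \<sim> a"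
      "b \<in> set B" "\<not> x \<sim> b" "c \<in> set (tl C)" "\<not> x \<sim> c"
      by blast
    have "a \<noteq> last A" using w xa by auto
    then have st: "a \<in> starts A" "c \<in> starts (rev C)"
      using A(1) C(1) w(7) last_or_butlast[OF w(3)] by auto
    then have "\<not> a \<sim> c" by (rule hooked_starts_nonadjacent[OF hk])
    have "c \<in> set C" using w tlC by blast
    have "independent_set G {x, h, a, b, c}"
    proof -
      have "\<not> h \<sim> a" "\<not> h \<sim> b" "\<not> h \<sim> c" using sep[OF w(1)] w \<open>c \<in> set C\<close> by blast+
      moreover have "h \<in> verts G" "a \<in> verts G" "b \<in> verts G" "c \<in> verts G"
        using w verts \<open>c \<in> set C\<close> hooked_detour(3)[OF hk] by blast+
      ultimately show ?thesis
        using w verts(4) \<open>\<not> a \<sim> c\<close> A(2)[OF st(1) w(5)] C(2)[OF st(2) w(5)]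
        by (simp add: independent_set_insert independent_set_empty)
    qed
    moreover have "card {x, h, a, b, c} = 5"
    proof -
      have "x \<noteq> h" "x \<noteq> a" "x \<noteq> b" "x \<noteq> c" "h \<noteq> a" "h \<noteq> b" "h \<noteq> c" "a \<noteq> b" "a \<noteq> c" "b \<noteq> c"
        using w x inter \<open>c \<in> set C\<close> by (metis disjoint_iff)+
      then show ?thesis by simp
    qed
    ultimately show False using bound by force
  qed
  then show ?thesis
  proof (elim disjE)
    assume "\<forall>h\<in>H. x \<sim> h"
    then show ?thesis
      by (intro card_neighbours_ge[of H x "last A" "hd B"]) (use xa xb mem inter in auto)
  next
    assume "\<forall>a\<in>set A. x \<sim> a"
    then show ?thesis
      by (intro card_neighbours_ge[of "set A" x "hd q" "hd B"]) (use xh xb mem inter cA in auto)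
  next
    assume "\<forall>b\<in>set B. x \<sim> b"
    then show ?thesis
      by (intro card_neighbours_ge[of "set B" x "hd q" "last A"]) (use xh xa mem inter cB in auto)
  next
    \<comment> \<open>The first vertex of \<open>C\<close> follows \<open>y\<close>, not \<open>x\<close>, so it is not counted as a neighbour of \<open>x\<close>;
      the neighbours in \<open>A\<close>, \<open>B\<close> and \<open>H\<close> make up for it.\<close>
    assume a: "\<forall>c\<in>set (tl C). x \<sim> c"
    have "hd q \<notin> set C" "hd B \<notin> set C" "last A \<notin> set C"
      using mem inter by (metis disjoint_iff)+
    then have "hd q \<notin> set (tl C)" "hd B \<notin> set (tl C)" "last A \<notin> set (tl C)"
      using tlC by (meson subsetD)+
    moreover have "hd q \<noteq> last A" "hd B \<noteq> last A" "hd q \<noteq> hd B"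
      using mem inter by (metis disjoint_iff)+
    ultimately have no: "hd q \<notin> set (tl C)" "hd B \<notin> set (tl C)" "last A \<notin> set (tl C)"
      "hd q \<noteq> last A" "hd B \<noteq> last A" "hd q \<noteq> hd B"
      by simp_all
    show ?thesis
    proof (rule card_neighbours_ge[of "insert (hd q) (set (tl C))" x "hd B" "last A"])
      show "card H \<le> card (insert (hd q) (set (tl C)))" using cC no by simp
      show "x \<sim> w" if "w \<in> insert (hd q) (set (tl C))" for w using that a xh by blast
      show "hd B \<notin> insert (hd q) (set (tl C))" "last A \<notin> insert (hd q) (set (tl C))"
        using no by (metis insert_iff)+
    qed (rule xb xa no(5))+
  qed
qed

section \<open>Sweeping through a clique\<close>

lemma clique_successively:
  assumes "distinct q" "\<And>a b. a \<in> set q \<Longrightarrow> b \<in> set q \<Longrightarrow> a \<noteq> b \<Longrightarrow> a \<sim> b"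
  shows "successively (\<sim>) q"
  using assms
proof (induction q)
  case (Cons a q)
  have "a \<sim> hd q" if "q \<noteq> []"
    using Cons.prems hd_in_set[OF that] by (intro Cons.prems(2)) auto
  then show ?case using Cons by (cases "q = []") (simp_all add: successively_Cons)
qed simp

lemma clique_vpath:
  assumes K: "K \<subseteq> verts G" "\<And>a b. a \<in> K \<Longrightarrow> b \<in> K \<Longrightarrow> a \<noteq> b \<Longrightarrow> a \<sim> b"
    and ends: "a \<in> K" "b \<in> K" "a \<noteq> b \<or> K = {a}"
  obtains q where "vpath q G" "set q = K" "hd q = a" "last q = b"
proof (cases "a = b")
  case True
  then show ?thesis using that[of "[a]"] ends K by (simp add: vpath_singleton)
next
  case False
  have "finite (K - {a, b})" using finite_subset[OF K(1) finite_verts] by simp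
  from finite_distinct_list[OF this] obtain xs where xs: "set xs = K - {a, b}" "distinct xs"
    by (elim exE conjE)
  let ?q = "a # xs @ [b]"
  have K_eq: "set ?q = K" and dist: "distinct ?q" using xs False ends(1,2) by auto
  have "successively (\<sim>) ?q"
    by (rule clique_successively[OF dist]) (use K(2) in \<open>simp only: K_eq\<close>)
  then have "vpath ?q G" unfolding vpath_iff using K_eq dist K(1) by simp
  then show ?thesis using that[of ?q] K_eq by simp
qed

lemma clique_vpath_from:
  assumes K: "K \<subseteq> verts G" "\<And>a b. a \<in> K \<Longrightarrow> b \<in> K \<Longrightarrow> a \<noteq> b \<Longrightarrow> a \<sim> b" and a: "a \<in> K"
  obtains q where "vpath q G" "set q = K" "hd q = a"
proof (cases "K = {a}")
  case True
  then show ?thesis using clique_vpath[OF K a a] that by blast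
next
  case False
  then obtain b where "b \<in> K" "a \<noteq> b" using a by blast
  then show ?thesis using clique_vpath[OF K a] that by blast
qed

lemma split_list_two:
  assumes "x \<in> set p" "y \<in> set p" "x \<noteq> y"
  obtains A B C where "p = A @ x # B @ y # C" | A B C where "p = A @ y # B @ x # C"
proof -
  obtain X Y where p: "p = X @ x # Y" using assms(1) by (meson split_list)
  then consider "y \<in> set X" | "y \<in> set Y" using assms by auto
  then show ?thesis
  proof cases
    case 1
    then obtain X1 X2 where "X = X1 @ y # X2" by (meson split_list)
    then show ?thesis using that(2) p by simp
  next
    case 2
    then obtain Y1 Y2 where "Y = Y1 @ y # Y2" by (meson split_list)
    then show ?thesis using that(1) p by simp
  qed
qed

section \<open>The component of a vertex off a longest path\<close>

definition component_avoiding :: "'a set \<Rightarrow> 'a \<Rightarrow> 'a set" where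
  "component_avoiding P v = {u. (v, u) \<in> {(a, b). a \<sim> b \<and> a \<notin> P \<and> b \<notin> P}\<^sup>*}"

lemma start_in_component: "v \<in> component_avoiding P v"
  by (simp add: component_avoiding_def)

lemma component_cases:
  assumes "u \<in> component_avoiding P v"
  shows "u = v \<or> u \<in> verts G \<and> u \<notin> P"
  using assms unfolding component_avoiding_def mem_Collect_eq
proof (cases rule: rtranclE)
  case base
  then show ?thesis by simp
next
  case (step y)
  then show ?thesis using adj_verts by blast
qed

lemma component_disjoint: "v \<notin> P \<Longrightarrow> component_avoiding P v \<inter> P = {}"
  using component_cases by blast

lemma component_subset_verts: "v \<in> verts G \<Longrightarrow> component_avoiding P v \<subseteq> verts G"
  using component_cases by blast

lemma component_closed:
  assumes "u \<in> component_avoiding P v" "u \<sim> w" "w \<notin> P" "v \<notin> P"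
  shows "w \<in> component_avoiding P v"
proof -
  have "u \<notin> P" using component_disjoint[OF assms(4)] assms(1) by blast
  then have "(u, w) \<in> {(a, b). a \<sim> b \<and> a \<notin> P \<and> b \<notin> P}" using assms by simp
  moreover have "(v, u) \<in> {(a, b). a \<sim> b \<and> a \<notin> P \<and> b \<notin> P}\<^sup>*"
    using assms(1) by (simp only: component_avoiding_def mem_Collect_eq)
  ultimately show ?thesis
    unfolding component_avoiding_def by (intro CollectI) (rule rtrancl_into_rtrancl)
qed

text \<open>The reachability proof only yields a walk, so a path that is about to revisit a vertex
  is cut back to it.\<close>

lemma path_avoiding:
  assumes "(u, w) \<in> {(a, b). a \<sim> b \<and> a \<notin> P \<and> b \<notin> P}\<^sup>*" "u \<in> verts G" "u \<notin> P"
  shows "\<exists>q. vpath q G \<and> hd q = u \<and> last q = w \<and> set q \<inter> P = {}"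
  using assms(1)
proof (induction rule: rtrancl_induct)
  case base
  show ?case using assms(2,3) by (intro exI[of _ "[u]"]) (simp add: vpath_singleton)
next
  case (step y z)
  then obtain q where q: "vpath q G" "hd q = u" "last q = y" "set q \<inter> P = {}" by blast
  have ne: "q \<noteq> []" using q by (simp add: vpath_iff)
  have z: "y \<sim> z" "z \<notin> P" using step by auto
  show ?case
  proof (cases "z \<in> set q")
    case True
    then obtain X Y where "q = X @ z # Y" by (meson split_list)
    then have q': "q = (X @ [z]) @ Y" by simp
    then have "vpath (X @ [z]) G"
      using q(1) vpath_append[of "X @ [z]" Y] by (cases "Y = []") auto
    moreover have "hd (X @ [z]) = u" using q(2) q' by (metis hd_append2 snoc_eq_iff_butlast)
    moreover have "set (X @ [z]) \<inter> P = {}" using q(4) q' by auto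
    ultimately show ?thesis by (intro exI[of _ "X @ [z]"]) simp
  next
    case False
    then have "vpath (q @ [z]) G"
      using q ne z adj_verts by (simp add: vpath_simps)
    then show ?thesis using q ne z by (intro exI[of _ "q @ [z]"]) simp
  qed
qed

lemma component_connected:
  assumes "v \<in> verts G" "v \<notin> P" "u \<in> component_avoiding P v" "w \<in> component_avoiding P v"
  obtains q where "vpath q G" "hd q = u" "last q = w" "set q \<inter> P = {}"
proof -
  let ?R = "{(a, b). a \<sim> b \<and> a \<notin> P \<and> b \<notin> P}"
  have "sym ?R" using adj_commute unfolding sym_def by blast
  then have "sym (?R\<^sup>*)" by (rule sym_rtrancl)
  moreover have vu: "(v, u) \<in> ?R\<^sup>*" and vw: "(v, w) \<in> ?R\<^sup>*"
    using assms(3,4) by (simp_all only: component_avoiding_def mem_Collect_eq)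
  ultimately have "(u, w) \<in> ?R\<^sup>*" using rtrancl_trans[OF symD[OF _ vu] vw] by blast
  show ?thesis
  proof -
    have "u \<in> verts G" "u \<notin> P"
      using assms(3) component_disjoint[OF assms(2)] component_subset_verts[OF assms(1)] by blast+
    from path_avoiding[OF \<open>(u, w) \<in> ?R\<^sup>*\<close> this] show ?thesis using that by (elim exE conjE)
  qed
qed

definition attachments :: "'a list \<Rightarrow> 'a \<Rightarrow> 'a set" where
  "attachments p v = {a \<in> set p. \<exists>h \<in> component_avoiding (set p) v. h \<sim> a}"

context
  fixes p :: "'a list" and v :: 'a and H :: "'a set"
  assumes lp: "longest_path G p" and v: "v \<in> verts G" "v \<notin> set p"
  defines "H \<equiv> component_avoiding (set p) v"
begin

lemma longest_vpath: "vpath p G"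
  using lp by (simp add: longest_path_def)

lemma component_off_path: "h \<in> H \<Longrightarrow> h \<notin> set p"
  using component_disjoint[OF v(2)] by (auto simp: H_def)

lemma component_verts: "H \<subseteq> verts G"
  using component_subset_verts[OF v(1)] by (simp add: H_def)

lemma component_hd_nonadjacent: "h \<in> H \<Longrightarrow> \<not> h \<sim> hd p"
proof
  assume h: "h \<in> H" "h \<sim> hd p"
  have "vpath (h # p) G"
    using longest_vpath h component_off_path[OF h(1)] by (simp add: vpath_Cons vpath_iff[of p])
  from longest_pathD[OF lp this] show False by simp
qed

lemma component_last_nonadjacent: "h \<in> H \<Longrightarrow> \<not> h \<sim> last p"
proof
  assume h: "h \<in> H" "h \<sim> last p"
  have "vpath (p @ [h]) G"
    using longest_vpath h component_off_path[OF h(1)] component_verts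
    by (auto simp: vpath_append vpath_singleton adj_commute vpath_iff[of p])
  from longest_pathD[OF lp this] show False by simp
qed

text \<open>The next three lemmas are the classical exchanges on a longest path: a
  path through \<open>H\<close> between consecutive attachments can be inserted; a vertex of \<open>H\<close> can be put in front
  of the path once the part up to its attachment is reversed, and the forbidden edge reconnects that part
  to the rest; and the part after one attachment up to the next can be reversed, with a path
  through \<open>H\<close> on its one side and the forbidden edge on its other side.\<close>

lemma no_consecutive_attachments:
  assumes p: "p = X @ Y" "X \<noteq> []" "Y \<noteq> []"
    and h: "h \<in> H" "h \<sim> last X" "h' \<in> H" "h' \<sim> hd Y"
  shows False
proof -
  obtain q where q: "vpath q G" "hd q = h" "last q = h'" "set q \<inter> set p = {}"
    using component_connected[OF v, of h h'] h unfolding H_def by blast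
  have ne: "q \<noteq> []" using q by (simp add: vpath_iff)
  have "vpath (X @ q @ Y) G"
    using longest_vpath p q h ne by (simp add: concat_simps)
  from longest_pathD[OF lp this] show False using ne p by simp
qed

lemma hd_successor_nonadjacent:
  assumes p: "p = X @ Y" "X \<noteq> []" "Y \<noteq> []" and h: "h \<in> H" "h \<sim> last X"
  shows "\<not> hd p \<sim> hd Y"
proof
  assume adj: "hd p \<sim> hd Y"
  have "vpath (h # rev X @ Y) G"
    using longest_vpath p h adj component_off_path[OF h(1)] by (simp add: concat_simps)
  from longest_pathD[OF lp this] show False using p by simp
qed

lemma successors_nonadjacent:
  assumes p: "p = X @ Y @ Z" "X \<noteq> []" "Y \<noteq> []" "Z \<noteq> []"
    and h: "h \<in> H" "h \<sim> last X" "h' \<in> H" "h' \<sim> last Y"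
  shows "\<not> hd Y \<sim> hd Z"
proof
  assume adj: "hd Y \<sim> hd Z"
  obtain q where q: "vpath q G" "hd q = h" "last q = h'" "set q \<inter> set p = {}"
    using component_connected[OF v, of h h'] h unfolding H_def by blast
  have ne: "q \<noteq> []" using q by (simp add: vpath_iff)
  have "vpath (X @ q @ rev Y @ Z) G"
    using longest_vpath p q h adj ne by (simp add: concat_simps)
  from longest_pathD[OF lp this] show False using ne p by simp
qed

lemma attachments_eq: "attachments p v = {a \<in> set p. \<exists>h\<in>H. h \<sim> a}"
  by (simp add: attachments_def H_def)

text \<open>By the three exchanges, \<open>K\<close>, the first vertex of the path and the successors of
  the attachments are independent of each other. Successors exist because the last vertex of the path
  is not an attachment.\<close>

lemma independent_with_successors:
  assumes K: "K \<subseteq> H" "independent_set G K"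
  shows "card K + card (attachments p v) + 1 \<le> independence_number G"
proof -
  define I where "I = {i. i < length p \<and> (\<exists>h\<in>H. h \<sim> p ! i)}"
  define S where "S = (\<lambda>i. p ! Suc i) ` I"
  have dist: "distinct p" and ne: "p \<noteq> []" and pv: "set p \<subseteq> verts G"
    using longest_vpath by (auto simp: vpath_iff)
  have I: "Suc i < length p" if "i \<in> I" for i
  proof -
    have "i \<noteq> length p - 1" using that component_last_nonadjacent ne by (auto simp: I_def last_conv_nth)
    then show ?thesis using that by (auto simp: I_def)
  qed
  have split: "p = take (Suc i) p @ drop (Suc i) p" "take (Suc i) p \<noteq> []" "drop (Suc i) p \<noteq> []"
    "last (take (Suc i) p) = p ! i" "hd (drop (Suc i) p) = p ! Suc i" if "i \<in> I" for i
    using I[OF that]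
    by (simp only: append_take_drop_id, auto simp: take_Suc_conv_app_nth hd_drop_conv_nth)
  have notI: "Suc i \<notin> I" if "i \<in> I" for i
    using no_consecutive_attachments[OF split(1-3)[OF that]] split(4,5)[OF that] that by (auto simp: I_def)
  have SH: "\<not> h \<sim> s" if "h \<in> H" "s \<in> S" for h s
    using that notI I by (auto simp: S_def I_def)
  have hdS: "\<not> hd p \<sim> s" if "s \<in> S" for s
  proof -
    obtain i h where i: "i \<in> I" "s = p ! Suc i" "h \<in> H" "h \<sim> p ! i"
      using \<open>s \<in> S\<close> by (auto simp: S_def I_def)
    then show ?thesis
      using hd_successor_nonadjacent[OF split(1-3)[OF i(1)] i(3)] split(4,5)[OF i(1)] by simp
  qed
  have SS: "\<not> p ! Suc i \<sim> p ! Suc j" if ij: "i \<in> I" "j \<in> I" "i < j" for i j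
  proof -
    define Y where "Y = drop (Suc i) (take (Suc j) p)"
    have "take (Suc j) p = take (Suc i) p @ Y"
      using ij(3) append_take_drop_id[of "Suc i" "take (Suc j) p"] by (simp add: Y_def min_def)
    then have p: "p = take (Suc i) p @ Y @ drop (Suc j) p"
      using split(1)[OF ij(2)] by simp
    have Y: "Y \<noteq> []" "last Y = p ! j" "hd Y = p ! Suc i"
      using ij I[OF ij(2)] split(4)[OF ij(2)] by (auto simp: Y_def hd_drop_conv_nth)
    obtain h h' where "h \<in> H" "h \<sim> p ! i" "h' \<in> H" "h' \<sim> p ! j" using ij by (auto simp: I_def)
    then show ?thesis
      using successors_nonadjacent[OF p split(2)[OF ij(1)] Y(1) split(3)[OF ij(2)]]
        Y(2,3) split(4)[OF ij(1)] split(5)[OF ij(2)] by simp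
  qed
  have S: "independent_set G S"
    unfolding independent_set_def
  proof (intro conjI ballI)
    show "S \<subseteq> verts G" using I pv by (auto simp: S_def)
    fix s t assume "s \<in> S" "t \<in> S"
    then obtain i j where "i \<in> I" "s = p ! Suc i" "j \<in> I" "t = p ! Suc j" by (auto simp: S_def)
    then show "\<not> s \<sim> t"
      using SS[of i j] SS[of j i] adj_irrefl[of s] adj_commute[of s t]
      by (cases i j rule: linorder_cases) simp_all
  qed
  have Sp: "S \<subseteq> set p" using I by (auto simp: S_def)
  have hdnS: "hd p \<notin> S" using I dist ne by (auto simp: S_def hd_conv_nth nth_eq_iff_index_eq)
  have fin: "finite I" "finite S" "finite K"
    using finite_subset[OF _ finite_verts] component_verts K by (auto simp: I_def S_def)
  have "independent_set G (insert (hd p) S)"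
    using S hdS ne pv by (auto simp: independent_set_insert)
  moreover have "\<not> h \<sim> s" if "h \<in> K" "s \<in> insert (hd p) S" for h s
    using that K SH component_hd_nonadjacent by blast
  ultimately have "independent_set G (K \<union> insert (hd p) S)"
    unfolding independent_set_def using K(2)[unfolded independent_set_def] adj_sym
    by (intro conjI ballI) (blast, metis Un_iff)
  then have "card (K \<union> insert (hd p) S) \<le> independence_number G"
    by (rule card_independent_set_le)
  moreover have "insert (hd p) S \<subseteq> set p" "K \<inter> set p = {}"
    using Sp ne K(1) component_off_path by auto
  then have "K \<inter> insert (hd p) S = {}" by blast
  then have "card (K \<union> insert (hd p) S) = card K + Suc (card S)"
    using fin hdnS by (simp add: card_Un_disjoint)
  moreover have "card S = card I"
    unfolding S_def
    by (rule card_image) (use I dist in \<open>auto simp: inj_on_def nth_eq_iff_index_eq\<close>)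
  moreover have "card (attachments p v) = card I"
  proof -
    have "attachments p v = (!) p ` I"
      by (auto simp: attachments_eq I_def in_set_conv_nth image_iff)
    moreover have "inj_on ((!) p) I"
      using dist by (auto simp: inj_on_def I_def nth_eq_iff_index_eq)
    ultimately show ?thesis by (simp add: card_image)
  qed
  ultimately show ?thesis by simp
qed

lemma neighbours_of_component: "h \<in> H \<Longrightarrow> h \<sim> w \<Longrightarrow> w \<in> H \<union> attachments p v"
  using component_closed[of h "set p" v w] v by (auto simp: attachments_eq H_def)

lemma hd_not_attached: "hd p \<in> verts G" "hd p \<notin> H" "hd p \<notin> attachments p v"
proof -
  have "hd p \<in> set p" "set p \<subseteq> verts G" using longest_vpath by (simp_all add: vpath_iff)
  then show "hd p \<in> verts G" "hd p \<notin> H" "hd p \<notin> attachments p v"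
    using component_off_path component_hd_nonadjacent unfolding attachments_eq by blast+
qed

lemma vertex_in_component: "v \<in> H"
  by (simp add: H_def start_in_component)

text \<open>Otherwise the attachments would separate \<open>v\<close> from the first vertex of the path.\<close>

lemma card_attachments_ge:
  assumes "k_connected k G"
  shows "k \<le> card (attachments p v)"
proof (rule ccontr)
  assume "\<not> ?thesis"
  then show False
    using k_connected_separator[OF assms, of "attachments p v" v H "hd p"]
      neighbours_of_component hd_not_attached vertex_in_component v longest_vpath
    by (auto simp: attachments_eq vpath_iff)
qed

text \<open>With \<open>k\<close> attachments, the independent set above has size \<open>card K + k + 1\<close>. This
  leaves room for a single vertex of \<open>H\<close> but not for two non-adjacent ones.\<close>

lemma attachments_tight:
  assumes "k_connected k G" "independence_number G \<le> k + 2"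
  shows "card (attachments p v) = k" "\<And>h h'. h \<in> H \<Longrightarrow> h' \<in> H \<Longrightarrow> h \<noteq> h' \<Longrightarrow> h \<sim> h'"
proof -
  have "independent_set G {v}"
    using v by (simp add: independent_set_insert independent_set_empty)
  then show eq: "card (attachments p v) = k"
    using independent_with_successors[of "{v}"] vertex_in_component card_attachments_ge[OF assms(1)] assms(2)
    by simp
  fix h h' assume h: "h \<in> H" "h' \<in> H" "h \<noteq> h'"
  show "h \<sim> h'"
  proof (rule ccontr)
    assume "\<not> h \<sim> h'"
    then have "independent_set G {h, h'}"
      using h component_verts by (auto simp: independent_set_insert independent_set_empty)
    then show False using independent_with_successors[of "{h, h'}"] h eq assms(2) by simp
  qed
qed

text \<open>If all edges from \<open>H\<close> to the attachments used the same vertex \<open>h\<close>, this vertex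
  would be a cut vertex, unless it is all of \<open>H\<close>.\<close>

lemma distinct_attaching_vertices:
  assumes con: "k_connected 2 G" and N: "attachments p v = {x, y}" "x \<noteq> y"
  obtains h h' where "h \<in> H" "h \<sim> x" "h' \<in> H" "h' \<sim> y" "h \<noteq> h' \<or> H = {h}"
proof -
  have "x \<in> attachments p v" "y \<in> attachments p v" using N by auto
  then obtain h h' where h: "h \<in> H" "h \<sim> x" "h' \<in> H" "h' \<sim> y" by (auto simp: attachments_eq)
  show ?thesis
  proof (cases "h \<noteq> h' \<or> H = {h}")
    case True
    then show ?thesis using that h by blast
  next
    case False
    then obtain u where u: "u \<in> H" "u \<noteq> h" using h by blast
    have "\<exists>g\<in>H. g \<noteq> h \<and> (g \<sim> x \<or> g \<sim> y)"
    proof (rule ccontr)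
      assume none: "\<not> ?thesis"
      show False
      proof (rule k_connected_separator[OF con, of "{h}" u "H - {h}" "hd p"])
        show "{h} \<subseteq> verts G" "u \<in> verts G - {h}" using u h(1) component_verts by auto
        show "hd p \<in> verts G - {h}" "hd p \<notin> H - {h}" using hd_not_attached(1,2) h(1) by auto
        show "card {h} < 2" "u \<in> H - {h}" using u by simp_all
        fix a b assume a: "a \<in> H - {h}" "a \<sim> b"
        then have "b \<noteq> x" "b \<noteq> y" using none by auto
        moreover have "b \<in> H \<union> attachments p v" using a by (intro neighbours_of_component) auto
        ultimately show "b \<in> H - {h} \<union> {h}" using N(1) by simp
      qed
    qed
    then obtain g where "g \<in> H" "g \<noteq> h" "g \<sim> x \<or> g \<sim> y" by blast
    then show ?thesis using that[of g h] that[of h g] h False by auto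
  qed
qed

context
  fixes k :: nat
  assumes con: "k_connected k G" and indep: "independence_number G \<le> k + 2"
begin

lemma neighbour_on_path_attached: "h \<in> H \<Longrightarrow> h \<sim> w \<Longrightarrow> w \<in> set p \<Longrightarrow> w \<in> attachments p v"
  by (auto simp: attachments_def H_def)

lemmas component_clique = attachments_tight(2)[OF con indep]

lemma path_component_disjoint: "set p \<inter> H = {}"
  using component_off_path by blast

lemma card_independent_set_bound: "independent_set G S \<Longrightarrow> card S < k + 3"
  using card_independent_set_le[of S] indep by simp

lemma attachedE:
  assumes "a \<in> attachments p v"
  obtains h where "a \<in> set p" "h \<in> H" "h \<sim> a" "a \<noteq> hd p" "a \<noteq> last p"
  using assms component_hd_nonadjacent component_last_nonadjacent
  by (auto simp: attachments_def H_def)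

lemma sweep_from_attachment:
  assumes "a \<in> attachments p v"
  shows "\<exists>q. vpath q G \<and> set q = H \<and> hd q \<sim> a" "\<exists>q. vpath q G \<and> set q = H \<and> last q \<sim> a"
proof -
  obtain h where h: "h \<in> H" "h \<sim> a" using assms by (rule attachedE)
  obtain q where q: "vpath q G" "set q = H" "hd q = h"
    using clique_vpath_from[OF component_verts component_clique h(1)] by blast
  then show "\<exists>q. vpath q G \<and> set q = H \<and> hd q \<sim> a" using h by blast
  show "\<exists>q. vpath q G \<and> set q = H \<and> last q \<sim> a"
    using q h by (intro exI[of _ "rev q"]) (simp add: vpath_rev last_rev)
qed

lemma large_degree_one_attachment:
  assumes k: "k = 1"
  shows "\<exists>x \<in> verts G. card H + 2 \<le> card {w. x \<sim> w}"
proof -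
  have p: "vpath p G" using lp by (simp add: longest_path_def)
  obtain x where x: "attachments p v = {x}"
    using attachments_tight(1)[OF con indep] k by (auto simp: card_1_singleton_iff)
  then have "x \<in> attachments p v" by simp
  then obtain h where h: "x \<in> set p" "x \<noteq> hd p" "x \<noteq> last p" by (rule attachedE)
  then obtain A C where pAC: "p = A @ [x] @ C" by (metis split_list append_Cons append_Nil)
  have ne: "A \<noteq> []" "C \<noteq> []" using h(2,3) pAC by auto
  have "hooked A [x] C H"
    unfolding hooked_def using ne lp pAC sweep_from_attachment[of x] x path_component_disjoint by simp
  moreover have "\<not> h \<sim> w" if "h \<in> H" "w \<in> set A \<union> set C" for h w
  proof
    assume "h \<sim> w"
    then have "w = x" using neighbour_on_path_attached[of h w] that pAC x by auto
    then show False using that p pAC by (auto simp: vpath_iff)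
  qed
  ultimately have "card H + 2 \<le> card {w. x \<sim> w}"
    by (rule degree_of_single_attachment) (use card_independent_set_bound k in auto)
  moreover have "x \<in> verts G" using h(1) p by (auto simp: vpath_iff)
  ultimately show ?thesis by blast
qed

lemma large_degree_two_attachments:
  assumes k: "k = 2"
  shows "\<exists>x \<in> verts G. card H + 2 \<le> card {w. x \<sim> w}"
proof -
  have p: "vpath p G" using lp by (simp add: longest_path_def)
  obtain x' y' where xy': "attachments p v = {x', y'}" "x' \<noteq> y'"
    using attachments_tight(1)[OF con indep] k by (auto simp: card_2_iff)
  then have "x' \<in> set p" "y' \<in> set p" by (auto simp: attachments_def)
  then obtain A x B y C where pABC: "p = A @ x # B @ y # C" and xy: "attachments p v = {x, y}" "x \<noteq> y"
    using split_list_two[OF _ _ xy'(2)] xy' by (metis insert_commute)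
  have att: "x \<in> attachments p v" "y \<in> attachments p v" using xy by auto
  obtain hx where hx: "hx \<in> H" "hx \<sim> x" "x \<in> set p" "x \<noteq> hd p" using att(1) by (rule attachedE)
  obtain hy where hy: "hy \<in> H" "hy \<sim> y" "y \<noteq> last p" using att(2) by (rule attachedE)
  have "B \<noteq> []"
    using no_consecutive_attachments[of "A @ [x]" "B @ y # C" hx hy] hx hy pABC by auto
  moreover have "A \<noteq> []" "C \<noteq> []" using hx(4) hy(3) pABC by auto
  ultimately have hk: "hooked A (x # B @ [y]) C H"
    unfolding hooked_def using lp pABC sweep_from_attachment[OF att(1)] sweep_from_attachment[OF att(2)] path_component_disjoint by simp
  obtain h h' where hh: "h \<in> H" "h \<sim> x" "h' \<in> H" "h' \<sim> y" "h \<noteq> h' \<or> H = {h}"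
    using distinct_attaching_vertices[OF con[unfolded k] xy] by blast
  obtain q where "vpath q G" "set q = H" "hd q = h" "last q = h'"
    using clique_vpath[OF component_verts component_clique hh(1,3,5)] by blast
  then have "crossed A x B y C H"
    unfolding crossed_def using hk \<open>B \<noteq> []\<close> hh by blast
  moreover have "\<not> h \<sim> w" if "h \<in> H" "w \<in> set A \<union> set B \<union> set C" for h w
  proof
    assume "h \<sim> w"
    then have "w = x \<or> w = y" using neighbour_on_path_attached[of h w] that pABC xy by auto
    then show False using that p pABC by (auto simp: vpath_iff)
  qed
  ultimately have "card H + 2 \<le> card {w. x \<sim> w}"
    by (rule degree_of_double_attachment) (use card_independent_set_bound k in auto)
  moreover have "x \<in> verts G" using hx(3) p by (auto simp: vpath_iff)
  ultimately show ?thesis by blast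
qed

lemma degree_off_path: "card {w. v \<sim> w} < card H + k"
proof -
  have fin: "finite H" using finite_subset[OF component_verts finite_verts] .
  have "{w. v \<sim> w} \<subseteq> (H - {v}) \<union> attachments p v"
    using neighbours_of_component[OF vertex_in_component] adj_irrefl by auto
  then have "card {w. v \<sim> w} \<le> card ((H - {v}) \<union> attachments p v)"
    by (intro card_mono) (use fin in \<open>auto simp: attachments_def\<close>)
  also have "\<dots> \<le> card (H - {v}) + card (attachments p v)" by (rule card_Un_le)
  also have "\<dots> < card H + k"
    using attachments_tight(1)[OF con indep] card_Diff1_less[OF fin vertex_in_component] by simp
  finally show ?thesis .
qed

end

end

end

section \<open>Longest paths contain the vertices of large degree\<close>

theorem theorem10:
  fixes G :: "('a, 'b) pre_digraph" and k :: nat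
  assumes "graph G"
    and "k \<in> {1, 2}"
    and "k_connected k G"
    and "independence_number G \<le> k + 2"
  shows "\<forall>p. longest_path G p \<longrightarrow>
           (\<forall>v \<in> verts G. int (out_degree G v) \<ge> int (max_degree G) - (2 - int k)
              \<longrightarrow> v \<in> set p)"
proof (intro allI ballI impI)
  fix p v
  assume lp: "longest_path G p" and v: "v \<in> verts G"
    and deg: "int (out_degree G v) \<ge> int (max_degree G) - (2 - int k)"
  interpret graph G by (rule assms(1))
  show "v \<in> set p"
  proof (rule ccontr)
    assume nv: "v \<notin> set p"
    define H where "H = component_avoiding (set p) v"
    note ctx = lp v nv assms(3,4)
    have "\<exists>x \<in> verts G. card H + 2 \<le> card {w. (x, w) \<in> arcs_ends G}"
      using assms(2) large_degree_one_attachment[OF ctx] large_degree_two_attachments[OF ctx] by (auto simp: H_def)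
    then obtain x where x: "x \<in> verts G" "card H + 2 \<le> out_degree G x"
      by (auto simp: out_degree_eq_card)
    have "out_degree G x \<le> max_degree G"
      unfolding max_degree_def using x(1) by (intro Max_ge) auto
    moreover have "out_degree G v < card H + k"
      using degree_off_path[OF ctx] by (simp add: out_degree_eq_card H_def)
    ultimately show False using x(2) deg by linarith
  qed
qed

end
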